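(* Let $k>0$ be a fixed constant (the Boltzmann constant). A random state function $p:(0,\infty)\times X\times\mathcal{A}\to\mathbb{R}_+$ satisfies Positivity, Conditioning, Continuity, Consistency, Zero Uniformity and Boundedness if and only if there exists a function $E:X\to\mathbb{R}$ such that $$p_t(a\mid A)=\frac{e^{-\frac{E(a)}{kt}}}{\sum_{b\in A}e^{-\frac{E(b)}{kt}}}\,\delta_a(A)$$ for all $(t,a,A)\in(0,\infty)\times X\times\mathcal{A}$. Moreover, the function $E$ is unique up to an additive constant.
   Context: $X$ is a set with $|X|\ge 2$; $\mathcal{A}$ is the collection of all finite nonempty subsets of $X$; $\mathbb{R}_+=[0,\infty)$. A random state function is a function $p:(0,\infty)\times X\times\mathcal{A}\to\mathbb{R}_+$, $(t,a,A)\mapsto p_t(a\mid A)$ (no further properties are assumed). For $B\subseteq A$, $p_t(B\mid A)=\sum_{b\in B}p_t(b\mid A)$. For $a,b\in X$, $p_t(a,b)=p_t(a\mid\{a,b\})$ and $r_t(a,b)=p_t(a,b)/p_t(b,a)$. $\delta_a(A)=1$ if $a\in A$ and $\delta_a(A)=0$ otherwise. Axioms: - Positivity: for every $(t,A)\in(0,\infty)\times\mathcal{A}$, $\sum_{a\in X}p_t(a\mid A)=1$, with $p_t(a\mid A)>0$ if and only if $a\in A$. - Conditioning: for every $(t,A)\in(0,\infty)\times\mathcal{A}$, $p_t(b\mid A)=p_t(b\mid B)\,p_t(B\mid A)$ for all $B\in\mathcal{A}$ with $B\subseteq A$ and all $b\in B$. - Continuity: for every $(a,A)\in X\times\mathcal{A}$,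 $\lim_{t\to s}p_t(a\mid A)$ exists for all $s\ge 0$ and coincides with $p_s(a\mid A)$ when $s>0$. The limit for $s=0$ (as $t\to 0^+$) is denoted $p_0(a\mid A)$, and $p_0(a,b)=p_0(a\mid\{a,b\})$. - Consistency: for all $a,b\in X$ and all $t>0$, $p_t(a,b)>p_t(b,a)$ implies $p_0(a,b)>p_0(b,a)$. - Zero Uniformity: for all $a,b\in X$, if $p_0(a,b)\ne 0$ and $p_0(a,b)\neq 1$, then $p_0(a,b)=1/2$. - Boundedness: for all $a,b\in X$, $\sup_{t,s\in(0,\infty)}\left|r_{\frac{1}{t+s}}(a,b)-r_{\frac1t}(a,b)\,r_{\frac1s}(a,b)\right|<\infty$. *)

theory Defs
  imports "HOL-Analysis.Analysis"
begin

text \<open>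
  The set \<open>X\<close> is a carrier, and \<open>p t a A\<close> stands for $p_t(a \mid A)$. As functions are
  total, every notion below only refers to values with \<open>t > 0\<close>, \<open>a \<in> X\<close> and \<open>A \<in> menus X\<close>;
  values outside this domain are never constrained.
\<close>

type_synonym 'a state_fun = "real \<Rightarrow> 'a \<Rightarrow> 'a set \<Rightarrow> real"

definition menus :: "'a set \<Rightarrow> 'a set set" where
  "menus X = {A. A \<subseteq> X \<and> finite A \<and> A \<noteq> {}}"

definition random_state_function :: "'a set \<Rightarrow> 'a state_fun \<Rightarrow> bool" where
  "random_state_function X p \<longleftrightarrow> (\<forall>t>0. \<forall>a\<in>X. \<forall>A\<in>menus X. 0 \<le> p t a A)"

definition set_prob :: "'a state_fun \<Rightarrow> real \<Rightarrow> 'a set \<Rightarrow> 'a set \<Rightarrow> real" where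
  "set_prob p t B A = (\<Sum>b\<in>B. p t b A)"

definition pair_prob :: "'a state_fun \<Rightarrow> real \<Rightarrow> 'a \<Rightarrow> 'a \<Rightarrow> real" where
  "pair_prob p t a b = p t a {a, b}"

definition odds :: "'a state_fun \<Rightarrow> real \<Rightarrow> 'a \<Rightarrow> 'a \<Rightarrow> real" where
  "odds p t a b = pair_prob p t a b / pair_prob p t b a"

text \<open>
  The limit $p_0(a \mid A)$ as $t \to 0^+$. It is meaningful only if the limit exists, which is
  part of \<open>continuity\<close>; \<open>consistency\<close> and \<open>zero_uniformity\<close> are to be used together with it.
\<close>

definition zero_prob :: "'a state_fun \<Rightarrow> 'a \<Rightarrow> 'a set \<Rightarrow> real" where
  "zero_prob p a A = Lim (at_right 0) (\<lambda>t. p t a A)"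

definition zero_pair_prob :: "'a state_fun \<Rightarrow> 'a \<Rightarrow> 'a \<Rightarrow> real" where
  "zero_pair_prob p a b = zero_prob p a {a, b}"

text \<open>\<open>X\<close> may be infinite, hence an unconditional sum rather than \<^const>\<open>sum\<close>.\<close>

definition positivity :: "'a set \<Rightarrow> 'a state_fun \<Rightarrow> bool" where
  "positivity X p \<longleftrightarrow>
     (\<forall>t>0. \<forall>A\<in>menus X.
        ((\<lambda>a. p t a A) has_sum 1) X \<and> (\<forall>a\<in>X. 0 < p t a A \<longleftrightarrow> a \<in> A))"

definition conditioning :: "'a set \<Rightarrow> 'a state_fun \<Rightarrow> bool" where
  "conditioning X p \<longleftrightarrow>
     (\<forall>t>0. \<forall>A\<in>menus X. \<forall>B\<in>menus X. B \<subseteq> A \<longrightarrow>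
        (\<forall>b\<in>B. p t b A = p t b B * set_prob p t B A))"

definition continuity :: "'a set \<Rightarrow> 'a state_fun \<Rightarrow> bool" where
  "continuity X p \<longleftrightarrow>
     (\<forall>a\<in>X. \<forall>A\<in>menus X. \<forall>s\<ge>0.
        \<exists>l. ((\<lambda>t. p t a A) \<longlongrightarrow> l) (at s within {0<..}) \<and> (0 < s \<longrightarrow> l = p s a A))"

definition consistency :: "'a set \<Rightarrow> 'a state_fun \<Rightarrow> bool" where
  "consistency X p \<longleftrightarrow>
     (\<forall>a\<in>X. \<forall>b\<in>X. \<forall>t>0.
        pair_prob p t a b > pair_prob p t b a \<longrightarrow> zero_pair_prob p a b > zero_pair_prob p b a)"

definition zero_uniformity :: "'a set \<Rightarrow> 'a state_fun \<Rightarrow> bool" where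
  "zero_uniformity X p \<longleftrightarrow>
     (\<forall>a\<in>X. \<forall>b\<in>X. zero_pair_prob p a b \<noteq> 0 \<and> zero_pair_prob p a b \<noteq> 1 \<longrightarrow>
        zero_pair_prob p a b = 1 / 2)"

definition boundedness :: "'a set \<Rightarrow> 'a state_fun \<Rightarrow> bool" where
  "boundedness X p \<longleftrightarrow>
     (\<forall>a\<in>X. \<forall>b\<in>X.
        bdd_above ((\<lambda>(t, s). \<bar>odds p (1 / (t + s)) a b - odds p (1 / t) a b * odds p (1 / s) a b\<bar>)
                   ` ({0<..} \<times> {0<..})))"

definition boltzmann_form :: "real \<Rightarrow> 'a set \<Rightarrow> 'a state_fun \<Rightarrow> ('a \<Rightarrow> real) \<Rightarrow> bool" where
  "boltzmann_form k X p E \<longleftrightarrow>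
     (\<forall>t>0. \<forall>a\<in>X. \<forall>A\<in>menus X.
        p t a A = exp (- (E a / (k * t))) / (\<Sum>b\<in>A. exp (- (E b / (k * t)))) * indicat_real A a)"

end

theory Submission
  imports Defs
begin

text \<open>
  The heart of the matter is that Boundedness, read in the inverse temperature $x = 1/t$, says that
  the odds $f(x) = r_{1/x}(a,b)$ are approximately multiplicative:
  $|f(x+y) - f(x) f(y)|$ is bounded. By Baker's superstability theorem such an $f$ is either bounded
  or exactly multiplicative (\<open>superstability_of_multiplicativity\<close>). Swapping $a$ and $b$ replaces
  $f$ by $1/f$, which satisfies the same hypothesis, so there are two possibilities.

  If $f$ or $1/f$ is unbounded, then it is multiplicative, positive and, by Continuity, continuous,
  so $f(x) = e^{cx}$ for some real $c$ (\<open>unbounded_odds_imp_exp\<close>). If both are bounded, then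
  neither $a$ nor $b$ can lose all its probability as $t \to 0$. Zero Uniformity then makes
  the limiting choice between them uniform, and by Consistency a tie in the limit forces
  a tie at every temperature: $f$ is constantly $1$ (\<open>bounded_odds_imp_uniform\<close>).
  In all cases $r_t(a,b) = e^{c/t}$ (\<open>odds_exp\<close>).

  Fixing a reference alternative $z$ and letting $-E(a)/k$ be the exponent of the odds of $a$
  against $z$ yields the energy. Conditioning says that the ratio of two probabilities is the same
  in every menu containing both alternatives, and a distribution on a finite menu is determined by
  these ratios; adding $z$ to a menu therefore gives the Boltzmann formula
  (\<open>axioms_imp_boltzmann_form\<close>).

  Conversely, the odds of a Boltzmann distribution are exactly multiplicative in the inverse
  temperature, and as $t \to 0$ the distribution on a menu tends to the uniform one on the
  minimizers of the energy (\<open>boltzmann_zero_limit\<close>), which gives the axioms about $p_0$. The odds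
  determine all energy differences, hence the energy up to a constant.
\<close>

section \<open>The exponential functional equation on the positive half-line\<close>

text \<open>
  The superstability theorem of Baker. Expanding $f(z+x+y)$ in two ways shows that $f(z)$ times the
  defect of multiplicativity at $(x,y)$ is bounded by a constant that depends on $y$ but not on $z$;
  a nonzero defect would therefore bound $f$.
\<close>

lemma superstability_of_multiplicativity:
  fixes f :: "'s::semigroup_add \<Rightarrow> 'b::real_normed_div_algebra"
  assumes closed: "\<And>x y. x \<in> S \<Longrightarrow> y \<in> S \<Longrightarrow> x + y \<in> S"
    and near: "\<And>x y. x \<in> S \<Longrightarrow> y \<in> S \<Longrightarrow> norm (f (x + y) - f x * f y) \<le> M"
    and unbounded: "\<not> bounded (f ` S)"
    and x: "x \<in> S" and y: "y \<in> S"
  shows "f (x + y) = f x * f y"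
proof (rule ccontr)
  assume ne: "f (x + y) \<noteq> f x * f y"
  define d where "d = norm (f (x + y) - f x * f y)"
  have d: "d > 0" using ne by (simp add: d_def)
  have "norm (f z) \<le> (2 * M + M * norm (f y)) / d" if z: "z \<in> S" for z
  proof -
    have "f z * (f (x + y) - f x * f y) =
        (f (z + x + y) - f (z + x) * f y) - (f (z + (x + y)) - f z * f (x + y))
          + (f (z + x) - f z * f x) * f y"
      by (simp add: algebra_simps)
    also have "norm \<dots> \<le> norm (f (z + x + y) - f (z + x) * f y)
        + norm (f (z + (x + y)) - f z * f (x + y)) + norm ((f (z + x) - f z * f x) * f y)"
      by (intro norm_triangle_le add_right_mono norm_triangle_ineq4)
    also have "\<dots> \<le> M + M + M * norm (f y)"
      unfolding norm_mult using x y z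
      by (intro add_mono mult_right_mono near closed) auto
    finally have "norm (f z) * d \<le> 2 * M + M * norm (f y)"
      by (simp add: norm_mult d_def)
    then show ?thesis using d by (simp add: field_simps)
  qed
  then have "bounded (f ` S)" by (auto simp: bounded_iff)
  with unbounded show False ..
qed

text \<open>
  Cauchy's functional equation on the half-line, where the usual use of $g(0) = 0$ and
  $g(-x) = -g(x)$ is not available: additivity settles the positive rationals, and continuity the rest.
\<close>

lemma continuous_additive_on_pos_is_linear:
  fixes g :: "real \<Rightarrow> real"
  assumes add: "\<And>x y. 0 < x \<Longrightarrow> 0 < y \<Longrightarrow> g (x + y) = g x + g y"
    and cont: "continuous_on {0<..} g"
    and x: "0 < x"
  shows "g x = g 1 * x"
proof -
  have mult: "g (real (Suc n) * y) = real (Suc n) * g y" if "0 < y" for n y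
  proof (induction n)
    case (Suc n)
    have "g (real (Suc (Suc n)) * y) = g (real (Suc n) * y + y)"
      by (simp add: algebra_simps)
    also have "\<dots> = g (real (Suc n) * y) + g y"
      using that by (intro add) auto
    finally show ?case using Suc by (simp add: algebra_simps)
  qed simp
  have mult': "g (real n * y) = real n * g y" if "0 < y" "0 < n" for n y
    using mult[of y "n - 1"] that by simp
  have rat: "g (real m / real n) = g 1 * (real m / real n)" if "0 < m" "0 < n" for m n
  proof -
    have "real n * g (real m / real n) = g (real m * 1)"
      using mult'[of "real m / real n" n] that by simp
    also have "\<dots> = real m * g 1" using that by (intro mult') auto
    finally show ?thesis using that by (simp add: field_simps)
  qed
  \<comment> \<open>Rational approximations from above, so that they stay positive.\<close>
  define q where "q n = real (nat \<lceil>real (Suc n) * x\<rceil>) / real (Suc n)" for n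
  have q_ge: "x \<le> q n" and q_le: "q n \<le> x + inverse (real (Suc n))" for n
  proof -
    have pos: "0 \<le> real (Suc n) * x" using x by simp
    have "real (Suc n) * x \<le> real (nat \<lceil>real (Suc n) * x\<rceil>)"
      by (rule real_nat_ceiling_ge)
    then show "x \<le> q n" unfolding q_def by (simp add: field_simps del: of_nat_Suc)
    have "real (nat \<lceil>real (Suc n) * x\<rceil>) \<le> real (Suc n) * x + 1"
      using pos by linarith
    then show "q n \<le> x + inverse (real (Suc n))"
      unfolding q_def by (simp add: field_simps del: of_nat_Suc)
  qed
  have q_lim: "q \<longlonglongrightarrow> x"
    by (rule tendsto_sandwich[OF _ _ tendsto_const LIMSEQ_inverse_real_of_nat_add[of x]])
       (simp_all add: q_ge q_le del: of_nat_Suc)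
  have "isCont g x"
    using cont x by (simp add: continuous_on_eq_continuous_at)
  then have "(\<lambda>n. g (q n)) \<longlonglongrightarrow> g x"
    using q_lim by (rule isCont_tendsto_compose)
  moreover have "g (q n) = g 1 * q n" for n
    unfolding q_def using x by (intro rat) auto
  ultimately have "(\<lambda>n. g 1 * q n) \<longlonglongrightarrow> g x" by simp
  moreover have "(\<lambda>n. g 1 * q n) \<longlonglongrightarrow> g 1 * x"
    by (intro tendsto_intros q_lim)
  ultimately show ?thesis by (rule LIMSEQ_unique)
qed

lemma continuous_nearly_multiplicative_unbounded_is_exp:
  fixes f :: "real \<Rightarrow> real"
  assumes pos: "\<And>x. 0 < x \<Longrightarrow> 0 < f x"
    and near: "\<And>x y. 0 < x \<Longrightarrow> 0 < y \<Longrightarrow> \<bar>f (x + y) - f x * f y\<bar> \<le> M"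
    and unbounded: "\<not> bounded (f ` {0<..})"
    and cont: "continuous_on {0<..} f"
  shows "\<exists>c. \<forall>x>0. f x = exp (c * x)"
proof -
  have mult: "f (x + y) = f x * f y" if "0 < x" "0 < y" for x y
    using that near by (intro superstability_of_multiplicativity[OF _ _ unbounded]) auto
  have "ln (f x) = ln (f 1) * x" if "0 < x" for x
  proof (rule continuous_additive_on_pos_is_linear[of "\<lambda>x. ln (f x)", OF _ _ that])
    show "continuous_on {0<..} (\<lambda>x. ln (f x))"
      using pos by (intro continuous_on_ln cont) force
    show "ln (f (x + y)) = ln (f x) + ln (f y)" if "0 < x" "0 < y" for x y
      using that pos[of x] pos[of y] by (simp add: mult ln_mult)
  qed
  then have "f x = exp (ln (f 1) * x)" if "0 < x" for x
    using that pos[OF that] by (metis exp_ln)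
  then show ?thesis by blast
qed

section \<open>Elementary consequences of the axioms\<close>

lemma pair_menu: "a \<in> X \<Longrightarrow> b \<in> X \<Longrightarrow> {a, b} \<in> menus X"
  by (simp add: menus_def)

lemma positivity_outside_menu:
  assumes "random_state_function X p" "positivity X p" "t > 0" "A \<in> menus X" "a \<in> X" "a \<notin> A"
  shows "p t a A = 0"
  using assms unfolding random_state_function_def positivity_def by force

lemma positivity_sum_menu:
  assumes "random_state_function X p" "positivity X p" "t > 0" "A \<in> menus X"
  shows "(\<Sum>a\<in>A. p t a A) = 1"
proof -
  have A: "finite A" "A \<subseteq> X" using assms(4) by (auto simp: menus_def)
  have "((\<lambda>a. p t a A) has_sum 1) X"
    using assms unfolding positivity_def by blast
  then have "((\<lambda>a. p t a A) has_sum 1) A"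
    using A positivity_outside_menu[OF assms] by (subst has_sum_cong_neutral[where T = X]) auto
  with has_sum_finite[OF A(1)] show ?thesis by (rule has_sum_unique)
qed

lemma positivity_pos:
  assumes "positivity X p" "t > 0" "A \<in> menus X" "a \<in> A"
  shows "p t a A > 0"
  using assms unfolding positivity_def menus_def by auto

lemma pair_prob_pos:
  assumes "positivity X p" "t > 0" "a \<in> X" "b \<in> X"
  shows "pair_prob p t a b > 0"
  unfolding pair_prob_def using assms by (simp add: positivity_pos[of X p] pair_menu)

lemma odds_pos:
  assumes "positivity X p" "t > 0" "a \<in> X" "b \<in> X"
  shows "odds p t a b > 0"
  unfolding odds_def using assms by (simp add: pair_prob_pos[of X p])

lemma odds_swap: "odds p t b a = inverse (odds p t a b)"
  by (simp add: odds_def)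

text \<open>
  Independence of irrelevant alternatives: restricting a menu to $\{a,b\}$ multiplies both
  probabilities by the same factor, so their ratio does not depend on the menu.
\<close>

lemma conditioning_odds:
  assumes pos: "positivity X p" and cond: "conditioning X p"
    and t: "t > 0" and A: "A \<in> menus X" and ab: "a \<in> A" "b \<in> A"
  shows "p t a A = odds p t a b * p t b A"
proof -
  have X: "a \<in> X" "b \<in> X" and B: "{a, b} \<subseteq> A" using A ab by (auto simp: menus_def)
  have "p t c A = p t c {a, b} * set_prob p t {a, b} A" if "c \<in> {a, b}" for c
    using cond t A B X that pair_menu[of a X b] unfolding conditioning_def by blast
  moreover have "p t b {a, b} > 0"
    using pos t pair_menu[OF X] by (rule positivity_pos) simp
  ultimately show ?thesis
    by (simp add: odds_def pair_prob_def insert_commute)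
qed

lemma continuity_zero_prob:
  assumes "continuity X p" "a \<in> X" "A \<in> menus X"
  shows "((\<lambda>t. p t a A) \<longlongrightarrow> zero_prob p a A) (at_right 0)"
proof -
  obtain l where l: "((\<lambda>t. p t a A) \<longlongrightarrow> l) (at_right 0)"
    using assms unfolding continuity_def by fastforce
  then show ?thesis
    unfolding zero_prob_def by (simp add: tendsto_Lim)
qed

lemma continuity_continuous_on:
  assumes "continuity X p" "a \<in> X" "A \<in> menus X"
  shows "continuous_on {0<..} (\<lambda>t. p t a A)"
  unfolding continuous_on_def
proof
  fix s :: real assume "s \<in> {0<..}"
  then obtain l where "((\<lambda>t. p t a A) \<longlongrightarrow> l) (at s within {0<..})" "l = p s a A"
    using assms unfolding continuity_def by (metis greaterThan_iff less_imp_le)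
  then show "((\<lambda>t. p t a A) \<longlongrightarrow> p s a A) (at s within {0<..})" by simp
qed

section \<open>Pairwise odds are exponential in the inverse temperature\<close>

text \<open>
  The bounds on both odds survive in the limit as $P \le M Q$ and $Q \le M P$, where $P$ and $Q$
  are the limiting probabilities of $a$ and $b$. As $P + Q = 1$, neither vanishes, so Zero Uniformity
  makes them equal, and Consistency excludes a strict preference at any positive temperature.
\<close>

lemma bounded_odds_imp_uniform:
  assumes rsf: "random_state_function X p" and pos: "positivity X p" and cont: "continuity X p"
    and cons: "consistency X p" and zu: "zero_uniformity X p"
    and ab: "a \<in> X" "b \<in> X" "a \<noteq> b"
    and le: "\<And>t. t > 0 \<Longrightarrow> odds p t a b \<le> M" "\<And>t. t > 0 \<Longrightarrow> odds p t b a \<le> M"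
    and t: "t > 0"
  shows "odds p t a b = 1"
proof -
  define P where "P = zero_pair_prob p a b"
  define Q where "Q = zero_pair_prob p b a"
  have Plim: "((\<lambda>t. pair_prob p t a b) \<longlongrightarrow> P) (at_right 0)"
    unfolding P_def pair_prob_def zero_pair_prob_def
    using cont ab by (intro continuity_zero_prob) (auto simp: pair_menu)
  have Qlim: "((\<lambda>t. pair_prob p t b a) \<longlongrightarrow> Q) (at_right 0)"
    unfolding Q_def pair_prob_def zero_pair_prob_def
    using cont ab by (intro continuity_zero_prob) (auto simp: pair_menu)
  have ev: "eventually (\<lambda>t::real. t > 0) (at_right 0)"
    by (rule eventually_at_right_less)
  have ppos: "pair_prob p t a b > 0" "pair_prob p t b a > 0" if "t > 0" for t
    using pair_prob_pos[OF pos that] ab by auto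
  have sum1: "pair_prob p t a b + pair_prob p t b a = 1" if "t > 0" for t
    using positivity_sum_menu[OF rsf pos that pair_menu[OF ab(1,2)]] ab(3)
    by (simp add: pair_prob_def insert_commute)
  have ple: "pair_prob p t a b \<le> M * pair_prob p t b a"
      "pair_prob p t b a \<le> M * pair_prob p t a b" if "t > 0" for t
    using le[OF that] ppos[OF that] by (auto simp: odds_def field_simps)
  have "((\<lambda>t. pair_prob p t a b + pair_prob p t b a) \<longlongrightarrow> 1) (at_right 0)"
    using ev sum1 by (intro tendsto_eventually) (auto elim: eventually_mono)
  then have PQ: "P + Q = 1"
    using tendsto_unique[OF _ tendsto_add[OF Plim Qlim]] by auto
  have "P \<le> M * Q"
    by (rule tendsto_le[OF _ tendsto_mult[OF tendsto_const Qlim] Plim])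
       (use ev ple in \<open>auto elim: eventually_mono\<close>)
  moreover have "Q \<le> M * P"
    by (rule tendsto_le[OF _ tendsto_mult[OF tendsto_const Plim] Qlim])
       (use ev ple in \<open>auto elim: eventually_mono\<close>)
  ultimately have "P \<noteq> 0" "P \<noteq> 1" using PQ by auto
  then have "P = 1 / 2"
    using zu ab unfolding zero_uniformity_def P_def by blast
  then have "P = Q" using PQ by simp
  then have "\<not> pair_prob p t a b > pair_prob p t b a" "\<not> pair_prob p t b a > pair_prob p t a b"
    using cons ab t unfolding consistency_def P_def Q_def by force+
  then show ?thesis using ppos[OF t] by (simp add: odds_def)
qed

lemma unbounded_odds_imp_exp:
  assumes pos: "positivity X p" and cont: "continuity X p" and bdd: "boundedness X p"
    and ab: "a \<in> X" "b \<in> X"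
    and unb: "\<not> bounded ((\<lambda>t. odds p (1 / t) a b) ` {0<..})"
  shows "\<exists>c. \<forall>t>0. odds p t a b = exp (c / t)"
proof -
  have near: "\<exists>M. \<forall>x>0. \<forall>y>0.
      \<bar>odds p (1 / (x + y)) a b - odds p (1 / x) a b * odds p (1 / y) a b\<bar> \<le> M"
    using bdd ab unfolding boundedness_def bdd_above_def by fastforce
  have "continuous_on {0<..} (\<lambda>t. odds p t a b)"
    unfolding odds_def
  proof (rule continuous_on_divide)
    show "continuous_on {0<..} (\<lambda>t. pair_prob p t a b)" "continuous_on {0<..} (\<lambda>t. pair_prob p t b a)"
      unfolding pair_prob_def using ab
      by (simp_all add: continuity_continuous_on[OF cont] pair_menu)
    show "\<forall>t\<in>{0<..}. pair_prob p t b a \<noteq> 0"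
      using pair_prob_pos[OF pos _ ab(2,1)] by force
  qed
  then have cont': "continuous_on {0<..} (\<lambda>x. odds p (1 / x) a b)"
    by (rule continuous_on_compose2) (auto intro!: continuous_intros)
  obtain c where c: "\<forall>x>0. odds p (1 / x) a b = exp (c * x)"
    using continuous_nearly_multiplicative_unbounded_is_exp
      [of "\<lambda>x. odds p (1 / x) a b", OF _ _ unb cont'] near odds_pos[OF pos _ ab] by fastforce
  have "odds p t a b = exp (c / t)" if "t > 0" for t
    using c[rule_format, of "1 / t"] that by simp
  then show ?thesis by blast
qed

text \<open>
  The distinction by boundedness has to be made for both orders of the pair: odds $e^{cx}$ with
  $c < 0$ are bounded in $x$, and it is the inverse odds that are then seen to be exponential.
\<close>

lemma odds_exp:
  assumes rsf: "random_state_function X p" and pos: "positivity X p" and cont: "continuity X p"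
    and cons: "consistency X p" and zu: "zero_uniformity X p" and bdd: "boundedness X p"
    and ab: "a \<in> X" "b \<in> X"
  shows "\<exists>c. \<forall>t>0. odds p t a b = exp (c / t)"
proof (cases "a = b")
  case True
  have "odds p t a b = exp (0 / t)" if "t > 0" for t
    using pair_prob_pos[OF pos that ab] True by (simp add: odds_def)
  then show ?thesis by blast
next
  case False
  consider "\<not> bounded ((\<lambda>t. odds p (1 / t) a b) ` {0<..})"
    | "\<not> bounded ((\<lambda>t. odds p (1 / t) b a) ` {0<..})"
    | "bounded ((\<lambda>t. odds p (1 / t) a b) ` {0<..})" "bounded ((\<lambda>t. odds p (1 / t) b a) ` {0<..})"
    by blast
  then show ?thesis
  proof cases
    case 1
    then show ?thesis by (rule unbounded_odds_imp_exp[OF pos cont bdd ab])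
  next
    case 2
    then obtain c where c: "\<forall>t>0. odds p t b a = exp (c / t)"
      using unbounded_odds_imp_exp[OF pos cont bdd ab(2,1)] by blast
    have "odds p t a b = exp (- c / t)" if "t > 0" for t
      using c that odds_swap[of p t a b] by (simp add: exp_minus)
    then show ?thesis by blast
  next
    case 3
    then obtain M N where
      MN: "\<And>t. t > 0 \<Longrightarrow> \<bar>odds p (1 / t) a b\<bar> \<le> M" "\<And>t. t > 0 \<Longrightarrow> \<bar>odds p (1 / t) b a\<bar> \<le> N"
      unfolding bounded_iff by fastforce
    have "odds p t a b \<le> max M N" "odds p t b a \<le> max M N" if "t > 0" for t
      using MN(1)[of "1 / t"] MN(2)[of "1 / t"] that by auto
    then have "odds p t a b = 1" if "t > 0" for t
      using bounded_odds_imp_uniform[OF rsf pos cont cons zu ab False _ _ that] by blast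
    then have "\<forall>t>0. odds p t a b = exp (0 / t)" by simp
    then show ?thesis by blast
  qed
qed

lemma axioms_imp_boltzmann_form:
  assumes k: "0 < k" and ne: "X \<noteq> {}"
    and rsf: "random_state_function X p" and pos: "positivity X p" and cond: "conditioning X p"
    and cont: "continuity X p"
    and cons: "consistency X p" and zu: "zero_uniformity X p" and bdd: "boundedness X p"
  shows "\<exists>E. boltzmann_form k X p E"
proof -
  obtain z where z: "z \<in> X" using ne by blast
  have "\<forall>a\<in>X. \<exists>c. \<forall>t>0. odds p t a z = exp (c / t)"
    using odds_exp[OF rsf pos cont cons zu bdd _ z] by blast
  then obtain c where c: "\<And>a t. a \<in> X \<Longrightarrow> t > 0 \<Longrightarrow> odds p t a z = exp (c a / t)"
    by metis
  \<comment> \<open>The exponents give energies relative to that of \<open>z\<close>; the sign and the factor \<open>k\<close>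
    turn \<open>c a / t\<close> into \<open>- E a / (k t)\<close>.\<close>
  define E where "E a = - (k * c a)" for a
  have weight: "exp (- (E a / (k * t))) = exp (c a / t)" for a t
    using k by (simp add: E_def)
  have "p t a A = exp (- (E a / (k * t))) / (\<Sum>b\<in>A. exp (- (E b / (k * t)))) * indicat_real A a"
    if t: "t > 0" and a: "a \<in> X" and A: "A \<in> menus X" for t a A
  proof (cases "a \<in> A")
    case False
    then show ?thesis using positivity_outside_menu[OF rsf pos t A a] by simp
  next
    case True
    define B where "B = insert z A"
    have AX: "A \<subseteq> X" using A by (simp add: menus_def)
    have B: "B \<in> menus X" "A \<subseteq> B" using A z by (auto simp: menus_def B_def)
    have inB: "p t b B = exp (c b / t) * p t z B" if "b \<in> A" for b
      using conditioning_odds[OF pos cond t B(1), of b z] that B(2) AX c[OF _ t, of b]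
      by (auto simp: B_def)
    \<comment> \<open>The restriction to \<open>A\<close> rescales the probabilities in \<open>B\<close> by a common factor. Its value
      comes from summing over \<open>A\<close>, and it cancels the unknown \<open>p t z B\<close>.\<close>
    define S where "S = set_prob p t A B"
    have "p t b B = p t b A * S" if "b \<in> A" for b
      using cond t A B that unfolding conditioning_def S_def by blast
    then have inA: "p t b A * S = exp (c b / t) * p t z B" if "b \<in> A" for b
      using that inB by simp
    have zB: "p t z B > 0" using pos t B(1) by (rule positivity_pos) (simp add: B_def)
    have "S = (\<Sum>b\<in>A. p t b A) * S" using positivity_sum_menu[OF rsf pos t A] by simp
    also have "\<dots> = (\<Sum>b\<in>A. exp (c b / t)) * p t z B"
      by (simp add: sum_distrib_right inA)
    finally have S: "S = (\<Sum>b\<in>A. exp (c b / t)) * p t z B" .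
    have "p t a A * (\<Sum>b\<in>A. exp (c b / t)) = exp (c a / t)"
      using inA[OF True] zB by (simp add: S)
    moreover have "(\<Sum>b\<in>A. exp (c b / t)) > 0"
      using A by (intro sum_pos) (auto simp: menus_def)
    ultimately show ?thesis
      using True by (simp add: weight field_simps)
  qed
  then show ?thesis unfolding boltzmann_form_def by blast
qed

section \<open>Boltzmann distributions satisfy the axioms\<close>

lemma boltzmann_form_shift:
  assumes "\<forall>a\<in>X. E' a = E a + c"
  shows "boltzmann_form k X p E' \<longleftrightarrow> boltzmann_form k X p E"
proof -
  have "exp (- (E' a / (k * t))) / (\<Sum>b\<in>A. exp (- (E' b / (k * t))))
      = exp (- (E a / (k * t))) / (\<Sum>b\<in>A. exp (- (E b / (k * t))))"
    if "a \<in> X" "A \<in> menus X" for a A t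
  proof -
    have w: "exp (- (E' b / (k * t))) = exp (- (E b / (k * t))) * exp (- (c / (k * t)))"
      if "b \<in> X" for b
      using that assms by (simp flip: exp_add add: add_divide_distrib)
    have "(\<Sum>b\<in>A. exp (- (E' b / (k * t))))
        = (\<Sum>b\<in>A. exp (- (E b / (k * t)))) * exp (- (c / (k * t)))"
      unfolding sum_distrib_right using that w by (intro sum.cong) (auto simp: menus_def)
    then show ?thesis using w that by simp
  qed
  then show ?thesis unfolding boltzmann_form_def by simp
qed

lemma partition_function_pos:
  "A \<in> menus X \<Longrightarrow> 0 < (\<Sum>b\<in>A. exp (- (E b / (k * t))) :: real)"
  by (intro sum_pos) (auto simp: menus_def)

lemma boltzmann_on_menu:
  assumes "boltzmann_form k X p E" "t > 0" "A \<in> menus X" "a \<in> A"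
  shows "p t a A = exp (- (E a / (k * t))) / (\<Sum>b\<in>A. exp (- (E b / (k * t))))"
proof -
  have "a \<in> X" using assms(3,4) by (auto simp: menus_def)
  with assms show ?thesis by (simp add: boltzmann_form_def)
qed

lemma boltzmann_odds:
  assumes bf: "boltzmann_form k X p E" and t: "t > 0" and ab: "a \<in> X" "b \<in> X"
  shows "odds p t a b = exp ((E b - E a) / (k * t))"
proof -
  have "(\<Sum>c\<in>{a, b}. exp (- (E c / (k * t)))) \<noteq> 0"
    using partition_function_pos[OF pair_menu[OF ab]] by (metis less_irrefl)
  then have "odds p t a b = exp (- (E a / (k * t))) / exp (- (E b / (k * t)))"
    unfolding odds_def pair_prob_def insert_commute[of b a]
    using boltzmann_on_menu[OF bf t pair_menu[OF ab], of a]
      boltzmann_on_menu[OF bf t pair_menu[OF ab], of b]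
    by simp
  then show ?thesis by (simp flip: exp_diff add: diff_divide_distrib)
qed

lemma boltzmann_positivity:
  assumes "boltzmann_form k X p E"
  shows "positivity X p"
  unfolding positivity_def
proof (intro allI impI ballI conjI)
  fix t :: real and A assume t: "0 < t" and A: "A \<in> menus X"
  have fin: "finite A" "A \<subseteq> X" using A by (auto simp: menus_def)
  have Z: "0 < (\<Sum>b\<in>A. exp (- (E b / (k * t))))" using A by (rule partition_function_pos)
  have out: "p t a A = 0" if "a \<in> X" "a \<notin> A" for a
    using assms t A that by (simp add: boltzmann_form_def)
  have "(\<Sum>a\<in>A. p t a A) = (\<Sum>a\<in>A. exp (- (E a / (k * t))) / (\<Sum>b\<in>A. exp (- (E b / (k * t)))))"
    by (intro sum.cong refl boltzmann_on_menu[OF assms t A])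
  also have "\<dots> = 1" using Z by (simp flip: sum_divide_distrib)
  finally have "((\<lambda>a. p t a A) has_sum 1) A" using fin by (simp add: has_sum_finite_iff)
  then show "((\<lambda>a. p t a A) has_sum 1) X"
    using out fin by (subst has_sum_cong_neutral[where T = A]) auto
  show "0 < p t a A \<longleftrightarrow> a \<in> A" if "a \<in> X" for a
    using out[OF that] boltzmann_on_menu[OF assms t A, of a] Z by (cases "a \<in> A") auto
qed

lemma boltzmann_conditioning:
  assumes "boltzmann_form k X p E"
  shows "conditioning X p"
  unfolding conditioning_def
proof (intro allI impI ballI)
  fix t :: real and A B b
  assume t: "0 < t" and A: "A \<in> menus X" and B: "B \<in> menus X" and BA: "B \<subseteq> A" and b: "b \<in> B"
  have "set_prob p t B A = (\<Sum>b\<in>B. exp (- (E b / (k * t)))) / (\<Sum>b\<in>A. exp (- (E b / (k * t))))"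
    unfolding set_prob_def sum_divide_distrib
    using BA by (intro sum.cong refl boltzmann_on_menu[OF assms t A]) auto
  moreover have "0 < (\<Sum>b\<in>B. exp (- (E b / (k * t))))" using B by (rule partition_function_pos)
  ultimately show "p t b A = p t b B * set_prob p t B A"
    using boltzmann_on_menu[OF assms t A, of b] boltzmann_on_menu[OF assms t B, of b] b BA
    by auto
qed

lemma tendsto_boltzmann_weight_at_right_0:
  assumes "0 < k" "0 \<le> d"
  shows "((\<lambda>t. exp (- (d / (k * t)))) \<longlongrightarrow> (if d = 0 then 1 else 0 :: real)) (at_right 0)"
proof (cases "d = 0")
  case False
  then have "0 < d / k" using assms by simp
  then have "filterlim (\<lambda>t. d / k * inverse t) at_top (at_right 0)"
    by (rule filterlim_tendsto_pos_mult_at_top[OF tendsto_const _ filterlim_inverse_at_top_right])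
  then have "((\<lambda>t. exp (- (d / k * inverse t))) \<longlongrightarrow> 0) (at_right 0)"
    by (intro filterlim_compose[OF exp_at_bot] filterlim_compose[OF filterlim_uminus_at_bot_at_top])
  then show ?thesis using False by (simp add: field_simps)
qed simp

text \<open>
  Each of the weights $e^{-E(b)/(kt)}$ may tend to $0$ or to infinity. Measuring
  energies from the ground state $m$ of the menu leaves the distribution unchanged and makes every
  weight converge, to $1$ for the ground states and to $0$ otherwise; the partition function
  then tends to the number of ground states, which is not $0$.
\<close>

lemma boltzmann_zero_limit:
  assumes bf: "boltzmann_form k X p E" and k: "0 < k"
    and A: "A \<in> menus X" and a: "a \<in> A"
  shows "((\<lambda>t. p t a A) \<longlongrightarrow>
      (if E a = Min (E ` A) then 1 / card {b\<in>A. E b = Min (E ` A)} else 0)) (at_right 0)"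
proof -
  define m where "m = Min (E ` A)"
  have fin: "finite A" "A \<noteq> {}" using A by (auto simp: menus_def)
  have m_le: "m \<le> E b" if "b \<in> A" for b
    using that fin by (simp add: m_def)
  have "m \<in> E ` A" unfolding m_def using fin by (intro Min_in) auto
  then have card: "card {b\<in>A. E b = m} \<noteq> 0" using fin by auto
  have w: "((\<lambda>t. exp (- ((E b - m) / (k * t)))) \<longlongrightarrow> (if E b = m then 1 else 0)) (at_right 0)"
    if "b \<in> A" for b
    using tendsto_boltzmann_weight_at_right_0[OF k, of "E b - m"] m_le[OF that] by simp
  have "((\<lambda>t. \<Sum>b\<in>A. exp (- ((E b - m) / (k * t)))) \<longlongrightarrow> (\<Sum>b\<in>A. if E b = m then 1 else 0))
      (at_right 0)"
    by (intro tendsto_sum w)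
  also have "(\<Sum>b\<in>A. if E b = m then 1 else 0) = real (card {b\<in>A. E b = m})"
    using fin by (simp flip: sum.inter_filter)
  finally have "((\<lambda>t. exp (- ((E a - m) / (k * t))) / (\<Sum>b\<in>A. exp (- ((E b - m) / (k * t)))))
      \<longlongrightarrow> (if E a = m then 1 else 0) / real (card {b\<in>A. E b = m})) (at_right 0)"
    using card by (intro tendsto_divide w a) auto
  moreover have "boltzmann_form k X p (\<lambda>b. E b - m)"
    using bf boltzmann_form_shift[of X "\<lambda>b. E b - m" E "- m"] by simp
  then have "eventually (\<lambda>t. exp (- ((E a - m) / (k * t))) /
      (\<Sum>b\<in>A. exp (- ((E b - m) / (k * t)))) = p t a A) (at_right 0)"
    using eventually_at_right_less[of "0::real"]
    by (auto elim!: eventually_mono simp: boltzmann_on_menu[OF _ _ A a])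
  ultimately have "((\<lambda>t. p t a A) \<longlongrightarrow> (if E a = m then 1 else 0) / real (card {b\<in>A. E b = m}))
      (at_right 0)"
    by (rule Lim_transform_eventually)
  then show ?thesis by (simp add: m_def if_distrib[of "\<lambda>x. x / _"] cong: if_cong)
qed

lemma boltzmann_continuity:
  assumes bf: "boltzmann_form k X p E" and k: "0 < k"
  shows "continuity X p"
  unfolding continuity_def
proof (intro ballI allI impI)
  fix a A and s :: real assume a: "a \<in> X" and A: "A \<in> menus X" and s: "0 \<le> s"
  let ?f = "\<lambda>t. exp (- (E a / (k * t))) / (\<Sum>b\<in>A. exp (- (E b / (k * t)))) * indicat_real A a"
  have eq: "p t a A = ?f t" if "t > 0" for t
    using bf a A that unfolding boltzmann_form_def by blast
  show "\<exists>l. ((\<lambda>t. p t a A) \<longlongrightarrow> l) (at s within {0<..}) \<and> (0 < s \<longrightarrow> l = p s a A)"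
  proof (cases "s = 0")
    case True
    show ?thesis
    proof (cases "a \<in> A")
      case True
      then show ?thesis using boltzmann_zero_limit[OF bf k A] \<open>s = 0\<close> by blast
    next
      case False
      then have "eventually (\<lambda>t. p t a A = 0) (at_right 0)"
        using eventually_at_right_less[of "0::real"] by (auto elim!: eventually_mono simp: eq)
      then have "((\<lambda>t. p t a A) \<longlongrightarrow> 0) (at_right 0)" by (rule tendsto_eventually)
      then show ?thesis using \<open>s = 0\<close> by auto
    qed
  next
    case False
    with s have s: "s > 0" by simp
    have "continuous_on {0<..} ?f"
    proof (intro continuous_intros ballI)
      show "(\<Sum>b\<in>A. exp (- (E b / (k * t)))) \<noteq> 0" for t
        using partition_function_pos[OF A, of E k t] by simp
    qed (use k in auto)
    then have "continuous_on {0<..} (\<lambda>t. p t a A)"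
      by (rule continuous_on_eq) (simp add: eq)
    then show ?thesis using s by (auto simp: continuous_on_def)
  qed
qed

lemma boltzmann_zero_pair_prob:
  assumes bf: "boltzmann_form k X p E" and k: "0 < k" and ab: "a \<in> X" "b \<in> X" "a \<noteq> b"
  shows "zero_pair_prob p a b = (if E a < E b then 1 else if E a = E b then 1 / 2 else 0)"
proof -
  have "zero_pair_prob p a b =
      (if E a = Min (E ` {a, b}) then 1 / card {c\<in>{a, b}. E c = Min (E ` {a, b})} else 0)"
    unfolding zero_pair_prob_def zero_prob_def
    by (intro tendsto_Lim boltzmann_zero_limit[OF bf k pair_menu[OF ab(1,2)]]) auto
  moreover have "{c\<in>{a, b}. E c = Min (E ` {a, b})} =
      (if E a < E b then {a} else if E a = E b then {a, b} else {b})"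
    by (auto simp: min_def)
  ultimately show ?thesis using ab(3) by (auto simp: min_def)
qed

lemma boltzmann_consistency:
  assumes bf: "boltzmann_form k X p E" and k: "0 < k"
  shows "consistency X p"
  unfolding consistency_def
proof (intro ballI allI impI)
  fix a b and t :: real
  assume ab: "a \<in> X" "b \<in> X" and t: "0 < t" and gt: "pair_prob p t b a < pair_prob p t a b"
  have "pair_prob p t b a > 0"
    using boltzmann_positivity[OF bf] t ab(2,1) by (rule pair_prob_pos)
  then have "1 < odds p t a b" using gt by (simp add: odds_def)
  then have "0 < (E b - E a) / (k * t)"
    using boltzmann_odds[OF bf t ab] by simp
  then have "E a < E b"
    using mult_pos_pos[OF k t] by (simp add: zero_less_divide_iff)
  moreover from this have "a \<noteq> b" by auto
  ultimately show "zero_pair_prob p b a < zero_pair_prob p a b"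
    using boltzmann_zero_pair_prob[OF bf k] ab by auto
qed

lemma boltzmann_zero_uniformity:
  assumes bf: "boltzmann_form k X p E" and k: "0 < k"
  shows "zero_uniformity X p"
  unfolding zero_uniformity_def
proof (intro ballI impI)
  fix a b assume ab: "a \<in> X" "b \<in> X" and ne: "zero_pair_prob p a b \<noteq> 0 \<and> zero_pair_prob p a b \<noteq> 1"
  show "zero_pair_prob p a b = 1 / 2"
  proof (cases "a = b")
    case True
    have "zero_pair_prob p a a = 1"
      unfolding zero_pair_prob_def zero_prob_def
      using boltzmann_zero_limit[OF bf k pair_menu[OF ab(1) ab(1)], of a]
      by (intro tendsto_Lim) (auto simp: Collect_conv_if)
    with ne True show ?thesis by simp
  next
    case False
    then show ?thesis using ne boltzmann_zero_pair_prob[OF bf k ab] by (auto split: if_splits)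
  qed
qed

lemma boltzmann_boundedness:
  assumes bf: "boltzmann_form k X p E"
  shows "boundedness X p"
  unfolding boundedness_def
proof (intro ballI bdd_aboveI2)
  fix a b and x :: "real \<times> real" assume ab: "a \<in> X" "b \<in> X" and x: "x \<in> {0<..} \<times> {0<..}"
  obtain t s where ts: "x = (t, s)" "0 < t" "0 < s" using x by auto
  have "odds p (1 / (t + s)) a b = odds p (1 / t) a b * odds p (1 / s) a b"
    using ts ab by (simp add: boltzmann_odds[OF bf] distrib_left add_divide_distrib flip: exp_add)
  then show "(case x of (t, s) \<Rightarrow>
      \<bar>odds p (1 / (t + s)) a b - odds p (1 / t) a b * odds p (1 / s) a b\<bar>) \<le> 0"
    by (simp add: ts)
qed

section \<open>Characterization and uniqueness of the energy\<close>

lemma boltzmann_energy_unique: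
  assumes k: "0 < k" and bf: "boltzmann_form k X p E" "boltzmann_form k X p E'"
  shows "\<exists>c. \<forall>a\<in>X. E' a = E a + c"
proof (cases "X = {}")
  case False
  then obtain z where z: "z \<in> X" by blast
  have "E' a = E a + (E' z - E z)" if "a \<in> X" for a
  proof -
    have "exp ((E' z - E' a) / k) = exp ((E z - E a) / k)"
      using boltzmann_odds[OF bf(1) zero_less_one that z]
        boltzmann_odds[OF bf(2) zero_less_one that z] by simp
    then have "E' z - E' a = E z - E a" using k by simp
    then show ?thesis by simp
  qed
  then show ?thesis by blast
qed simp

theorem theorem1:
  fixes X :: "'a set" and p :: "'a state_fun" and k :: real
  assumes "infinite X \<or> 2 \<le> card X"
    and "0 < k"
    and "random_state_function X p"
  shows "(positivity X p \<and> conditioning X p \<and> continuity X p \<and>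
            consistency X p \<and> zero_uniformity X p \<and> boundedness X p
          \<longleftrightarrow> (\<exists>E. boltzmann_form k X p E)) \<and>
         (\<forall>E E'. boltzmann_form k X p E \<longrightarrow>
            (boltzmann_form k X p E' \<longleftrightarrow> (\<exists>c. \<forall>a\<in>X. E' a = E a + c)))"
proof (intro conjI allI impI)
  have ne: "X \<noteq> {}" using assms(1) by auto
  show "positivity X p \<and> conditioning X p \<and> continuity X p \<and>
      consistency X p \<and> zero_uniformity X p \<and> boundedness X p
      \<longleftrightarrow> (\<exists>E. boltzmann_form k X p E)"
    using axioms_imp_boltzmann_form[OF assms(2) ne assms(3)]
      boltzmann_positivity[of k X p] boltzmann_conditioning[of k X p]
      boltzmann_continuity[OF _ assms(2), of X p] boltzmann_consistency[OF _ assms(2), of X p]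
      boltzmann_zero_uniformity[OF _ assms(2), of X p] boltzmann_boundedness[of k X p]
    by blast
  show "boltzmann_form k X p E' \<longleftrightarrow> (\<exists>c. \<forall>a\<in>X. E' a = E a + c)"
    if "boltzmann_form k X p E" for E E'
    using boltzmann_energy_unique[OF assms(2) that] boltzmann_form_shift[of X E' E] that by blast
qed

end
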